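(* Let $n\ge 2$ be an integer and let $p:E\to B$ and $q:X\to Y$ be fibrations. If there are homotopy equivalences $f':E\to X$ and $f:B\to Y$ such that $q\circ f'=f\circ p$, then $$\mathrm{TC}_n[p:E\to B]=\mathrm{TC}_n[q:X\to Y].$$
   Context: For a fibration $p:E\to B$, let $E^n_B=\{(e_1,\dots,e_n)\in E^n\mid p(e_1)=\dots=p(e_n)\}$, and let $E^I_B$ be the subspace of the path space $E^I$ (compact-open topology, $I=[0,1]$) consisting of the paths $\gamma$ with $p\circ\gamma$ constant. Let $\Pi_n:E^I_B\to E^n_B$ be the fibration $$\Pi_n(\gamma)=\Big(\gamma(0),\gamma\big(\tfrac{1}{n-1}\big),\dots,\gamma\big(\tfrac{n-2}{n-1}\big),\gamma(1)\Big).$$ The sequential parametrized topological complexity $\mathrm{TC}_n[p:E\to B]$ is the least integer $r\ge 0$ such that $E^n_B$ has an open cover $\{U_0,\dots,U_r\}$ with each $U_i$ admitting a continuous section of $\Pi_n$ ($\infty$ if there is no such $r$). *)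

theory Defs
  imports "HOL-Analysis.Analysis" "HOL-Library.Extended_Nat"
begin

abbreviation unit_interval :: "real topology"
  where "unit_interval \<equiv> top_of_set {0..1}"

section \<open>Mapping spaces with the compact-open topology\<close>

text \<open>Continuous maps are made extensional outside \<open>topspace X\<close>, so that each map between the
  underlying spaces is represented by exactly one point.\<close>

definition continuous_maps :: "'a topology \<Rightarrow> 'b topology \<Rightarrow> ('a \<Rightarrow> 'b) set"
  where "continuous_maps X Y = {g. continuous_map X Y g} \<inter> extensional (topspace X)"

definition compact_open_topology :: "'a topology \<Rightarrow> 'b topology \<Rightarrow> ('a \<Rightarrow> 'b) topology"
  where "compact_open_topology X Y =
    topology_generated_by
      {{g \<in> continuous_maps X Y. g ` K \<subseteq> U} | K U. compactin X K \<and> openin Y U}"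

lemma topspace_compact_open_topology [simp]:
  "topspace (compact_open_topology X Y) = continuous_maps X Y"
proof -
  have "continuous_maps X Y
      \<in> {{g \<in> continuous_maps X Y. g ` K \<subseteq> U} | K U. compactin X K \<and> openin Y U}"
    by (rule CollectI, rule exI[of _ "{}"], rule exI[of _ "{}"]) auto
  then show ?thesis
    unfolding compact_open_topology_def topology_generated_by_topspace by blast
qed

abbreviation path_space :: "'a topology \<Rightarrow> (real \<Rightarrow> 'a) topology"
  where "path_space X \<equiv> compact_open_topology unit_interval X"

lemma continuous_map_path_eval:
  "continuous_map (prod_topology unit_interval (path_space B)) B (\<lambda>(t, \<beta>). \<beta> t)"
  unfolding continuous_map_def
proof (intro conjI allI impI)
  show "(\<lambda>(t, \<beta>). \<beta> t) \<in> topspace (prod_topology unit_interval (path_space B)) \<rightarrow> topspace B"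
    by (auto simp: continuous_maps_def continuous_map_def)
next
  fix V assume V: "openin B V"
  let ?S = "{x \<in> topspace (prod_topology unit_interval (path_space B)). (case x of (t, \<beta>) \<Rightarrow> \<beta> t) \<in> V}"
  show "openin (prod_topology unit_interval (path_space B)) ?S"
  proof (subst openin_subopen, intro ballI)
    fix x assume x: "x \<in> ?S"
    obtain t \<beta> where tb: "x = (t, \<beta>)" by (cases x)
    have t: "t \<in> {0..1}" and b: "\<beta> \<in> continuous_maps unit_interval B" and bt: "\<beta> t \<in> V"
      using x tb by auto
    have "openin unit_interval {s \<in> {0..1}. \<beta> s \<in> V}"
      using b V by (auto simp: continuous_maps_def continuous_map_def)
    then obtain r where r: "r > 0" "\<And>s. s \<in> {0..1} \<Longrightarrow> dist s t < r \<Longrightarrow> \<beta> s \<in> V"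
      using t bt unfolding openin_euclidean_subtopology_iff by blast
    define K where "K = cball t (r/2) \<inter> {0..1}"
    have K: "compactin unit_interval K"
      unfolding K_def compactin_subtopology by (auto intro: closed_Int_compact)
    have KV: "\<beta> ` K \<subseteq> V"
      using r by (auto simp: K_def dist_commute)
    define N where "N = {g \<in> continuous_maps unit_interval B. g ` K \<subseteq> V}"
    have N: "openin (path_space B) N"
      unfolding compact_open_topology_def N_def
      by (rule topology_generated_by_Basis) (use K V in blast)
    have "openin unit_interval (ball t (r/2) \<inter> {0..1})"
      by (metis Int_commute openin_open open_ball)
    with N have "openin (prod_topology unit_interval (path_space B)) ((ball t (r/2) \<inter> {0..1}) \<times> N)"
      by (simp add: openin_prod_Times_iff)
    moreover have "x \<in> (ball t (r/2) \<inter> {0..1}) \<times> N"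
      using tb t b KV r by (auto simp: N_def)
    moreover have "(ball t (r/2) \<inter> {0..1}) \<times> N \<subseteq> ?S"
      by (auto simp: N_def K_def)
    ultimately show "\<exists>T. openin (prod_topology unit_interval (path_space B)) T \<and> x \<in> T \<and> T \<subseteq> ?S"
      by blast
  qed
qed

lemma continuous_map_path_curry:
  assumes h: "continuous_map (prod_topology unit_interval Z) B h"
  shows "continuous_map Z (path_space B) (\<lambda>z. restrict (\<lambda>t. h (t, z)) {0..1})"
proof -
  have mem: "restrict (\<lambda>t. h (t, z)) {0..1} \<in> continuous_maps unit_interval B"
    if z: "z \<in> topspace Z" for z
  proof -
    have "continuous_map unit_interval B (h \<circ> (\<lambda>t. (t, z)))"
      by (rule continuous_map_compose[OF _ h]) (simp add: continuous_map_pairedI z)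
    then have "continuous_map unit_interval B (restrict (\<lambda>t. h (t, z)) {0..1})"
      by (rule continuous_map_eq) auto
    then show ?thesis
      by (simp add: continuous_maps_def)
  qed
  show ?thesis
    unfolding compact_open_topology_def
  proof (rule continuous_on_generated_topo)
    fix N assume "N \<in> {{g \<in> continuous_maps unit_interval B. g ` K \<subseteq> U} | K U.
        compactin unit_interval K \<and> openin B U}"
    then obtain K U where N: "N = {g \<in> continuous_maps unit_interval B. g ` K \<subseteq> U}"
      and K: "compactin unit_interval K" and U: "openin B U" by blast
    have K01: "K \<subseteq> {0..1}"
      using compactin_subset_topspace[OF K] by simp
    let ?P = "(\<lambda>z. restrict (\<lambda>t. h (t, z)) {0..1}) -` N \<inter> topspace Z"
    let ?W = "{x \<in> topspace (prod_topology unit_interval Z). h x \<in> U}"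
    have W: "openin (prod_topology unit_interval Z) ?W"
      by (rule openin_continuous_map_preimage[OF h U])
    show "openin Z ?P"
    proof (subst openin_subopen, intro ballI)
      fix z assume z: "z \<in> ?P"
      have "h (t, z) \<in> U" if t: "t \<in> K" for t
      proof -
        have "restrict (\<lambda>t. h (t, z)) {0..1} t \<in> U"
          using z t unfolding N by blast
        moreover have "t \<in> {0..1}"
          using t K01 by (rule subsetD[rotated])
        ultimately show ?thesis
          by (simp only: restrict_apply')
      qed
      moreover have "(t, z) \<in> topspace (prod_topology unit_interval Z)" if "t \<in> K" for t
        using z subsetD[OF K01 that] by simp
      ultimately have KW: "K \<times> {z} \<subseteq> ?W"
        by blast
      have zZ: "z \<in> topspace Z"
        using z by (rule IntD2)
      from tube_lemma_left[OF W K zZ KW]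
      obtain A V where AV: "openin Z V" "K \<subseteq> A" "z \<in> V" "A \<times> V \<subseteq> ?W"
        by (elim exE conjE)
      have "V \<subseteq> ?P"
      proof
        fix v assume v: "v \<in> V"
        have vz: "v \<in> topspace Z"
          using openin_subset[OF AV(1)] v by (rule subsetD)
        have "restrict (\<lambda>t. h (t, v)) {0..1} t \<in> U" if t: "t \<in> K" for t
        proof -
          have "(t, v) \<in> ?W"
            using subsetD[OF AV(4)] v subsetD[OF AV(2) t] by (meson SigmaI)
          then have "h (t, v) \<in> U"
            by (rule CollectE) (erule conjunct2)
          with subsetD[OF K01 t] show ?thesis
            by (simp only: restrict_apply')
        qed
        then have "restrict (\<lambda>t. h (t, v)) {0..1} \<in> N"
          unfolding N using mem[OF vz] by (intro CollectI conjI image_subsetI)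
        then show "v \<in> ?P"
          using vz by (intro IntI vimageI2)
      qed
      with AV show "\<exists>T. openin Z T \<and> z \<in> T \<and> T \<subseteq> ?P" by blast
    qed
  next
    show "(\<lambda>z. restrict (\<lambda>t. h (t, z)) {0..1}) ` topspace Z \<subseteq>
      \<Union>{{g \<in> continuous_maps unit_interval B. g ` K \<subseteq> U} | K U. compactin unit_interval K \<and> openin B U}"
      using mem topspace_compact_open_topology[of unit_interval B]
      unfolding compact_open_topology_def topology_generated_by_topspace by blast
  qed
qed

section \<open>Fibrations\<close>

definition homotopy_lifting_property ::
  "'z topology \<Rightarrow> 'e topology \<Rightarrow> 'b topology \<Rightarrow> ('e \<Rightarrow> 'b) \<Rightarrow> bool"
  where "homotopy_lifting_property Z E B p \<longleftrightarrow>
    (\<forall>h k. continuous_map (prod_topology unit_interval Z) B h \<and> continuous_map Z E k \<and>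
        (\<forall>z\<in>topspace Z. p (k z) = h (0, z)) \<longrightarrow>
      (\<exists>H. continuous_map (prod_topology unit_interval Z) E H \<and>
        (\<forall>z\<in>topspace Z. H (0, z) = k z) \<and>
        (\<forall>t\<in>{0..1}. \<forall>z\<in>topspace Z. p (H (t, z)) = h (t, z))))"

text \<open>Fibrations in the sense of Hurewicz: homotopies lift from every space \<open>Z\<close>. HOL cannot
  quantify over the type of points of \<open>Z\<close>, so the definition ranges over all topologies on one
  type, large enough to carry the fibre product of \<open>E\<close> and the path space of \<open>B\<close>. By lemma
  \<open>fibration_imp_homotopy_lifting_property\<close> below, lifting then holds for spaces over every type.\<close>

definition fibration :: "'e topology \<Rightarrow> 'b topology \<Rightarrow> ('e \<Rightarrow> 'b) \<Rightarrow> bool"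
  where "fibration E B p \<longleftrightarrow>
    continuous_map E B p \<and>
    (\<forall>Z :: ('e \<times> (real \<Rightarrow> 'b)) topology. homotopy_lifting_property Z E B p)"

lemma fibration_imp_homotopy_lifting_property:
  fixes Z :: "'z topology" and E :: "'e topology" and B :: "'b topology"
  assumes "fibration E B p"
  shows "homotopy_lifting_property Z E B p"
  unfolding homotopy_lifting_property_def
proof (intro allI impI, elim conjE)
  fix h k
  assume h: "continuous_map (prod_topology unit_interval Z) B h"
    and k: "continuous_map Z E k"
    and hk: "\<forall>z\<in>topspace Z. p (k z) = h (0, z)"
  define M where "M = {(e, \<beta>). p e = \<beta> (0::real)}"
  define W where "W = subtopology (prod_topology E (path_space B)) M"
  have fst_W: "continuous_map W E fst"
    unfolding W_def by (simp add: continuous_map_from_subtopology continuous_map_fst)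
  have snd_W: "continuous_map W (path_space B) snd"
    unfolding W_def by (simp add: continuous_map_from_subtopology continuous_map_snd)
  have "continuous_map (prod_topology unit_interval W) B
      ((\<lambda>(t, \<beta>). \<beta> t) \<circ> (\<lambda>x. (fst x, snd (snd x))))"
    by (intro continuous_map_compose[OF _ continuous_map_path_eval] continuous_map_pairedI
          continuous_map_fst continuous_map_compose[OF continuous_map_snd snd_W, unfolded o_def])
  moreover have "\<forall>w\<in>topspace W. p (fst w) = ((\<lambda>(t, \<beta>). \<beta> t) \<circ> (\<lambda>x. (fst x, snd (snd x)))) (0::real, w)"
    by (auto simp: W_def M_def)
  moreover have "homotopy_lifting_property W E B p"
    using assms unfolding fibration_def by blast
  ultimately obtain L where L: "continuous_map (prod_topology unit_interval W) E L"
    and L0: "\<forall>w\<in>topspace W. L (0, w) = fst w"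
    and Lp: "\<forall>t\<in>{0..1}. \<forall>w\<in>topspace W.
      p (L (t, w)) = ((\<lambda>(t, \<beta>). \<beta> t) \<circ> (\<lambda>x. (fst x, snd (snd x)))) (t, w)"
    using fst_W unfolding homotopy_lifting_property_def by blast
  define \<phi> where "\<phi> z = (k z, restrict (\<lambda>t. h (t, z)) {0..1})" for z
  have "continuous_map Z (prod_topology E (path_space B)) \<phi>"
    unfolding \<phi>_def by (intro continuous_map_pairedI k continuous_map_path_curry h)
  moreover have "\<phi> z \<in> M" if "z \<in> topspace Z" for z
    using that hk by (simp add: \<phi>_def M_def)
  ultimately have \<phi>: "continuous_map Z W \<phi>"
    unfolding W_def by (auto simp: continuous_map_in_subtopology)
  have \<phi>W: "\<phi> z \<in> topspace W" if "z \<in> topspace Z" for z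
    using \<phi> that by (auto simp: continuous_map_def)
  have "continuous_map (prod_topology unit_interval Z) E (L \<circ> (\<lambda>x. (fst x, \<phi> (snd x))))"
    by (intro continuous_map_compose[OF _ L] continuous_map_pairedI
          continuous_map_fst continuous_map_compose[OF continuous_map_snd \<phi>, unfolded o_def])
  moreover have "\<forall>z\<in>topspace Z. (L \<circ> (\<lambda>x. (fst x, \<phi> (snd x)))) (0, z) = k z"
    using L0 \<phi>W by (simp add: \<phi>_def)
  moreover have "\<forall>t\<in>{0..1}. \<forall>z\<in>topspace Z. p ((L \<circ> (\<lambda>x. (fst x, \<phi> (snd x)))) (t, z)) = h (t, z)"
    using Lp \<phi>W by (simp add: \<phi>_def)
  ultimately show "\<exists>H. continuous_map (prod_topology unit_interval Z) E H \<and>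
        (\<forall>z\<in>topspace Z. H (0, z) = k z) \<and>
        (\<forall>t\<in>{0..1}. \<forall>z\<in>topspace Z. p (H (t, z)) = h (t, z))"
    by blast
qed

section \<open>Homotopy equivalences\<close>

definition homotopy_equivalence_map :: "'a topology \<Rightarrow> 'b topology \<Rightarrow> ('a \<Rightarrow> 'b) \<Rightarrow> bool"
  where "homotopy_equivalence_map X Y f \<longleftrightarrow>
    continuous_map X Y f \<and>
    (\<exists>g. continuous_map Y X g \<and>
      homotopic_with (\<lambda>x. True) X X (g \<circ> f) id \<and>
      homotopic_with (\<lambda>x. True) Y Y (f \<circ> g) id)"

lemma homotopy_equivalent_space_iff_map:
  "X homotopy_equivalent_space Y \<longleftrightarrow> (\<exists>f. homotopy_equivalence_map X Y f)"
  unfolding homotopy_equivalent_space_def homotopy_equivalence_map_def by blast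

section \<open>Sequential parametrized topological complexity\<close>

text \<open>\<open>fibre_power n E p\<close> is $E^n_B$, with coordinates indexed by \<open>0, \<dots>, n - 1\<close>, and
  \<open>fibre_path_space E p\<close> is $E^I_B$. The base \<open>B\<close> enters only through \<open>p\<close>.\<close>

definition fibre_power :: "nat \<Rightarrow> 'e topology \<Rightarrow> ('e \<Rightarrow> 'b) \<Rightarrow> (nat \<Rightarrow> 'e) topology"
  where "fibre_power n E p =
    subtopology (product_topology (\<lambda>i. E) {..<n}) {e. \<forall>i<n. \<forall>j<n. p (e i) = p (e j)}"

definition fibre_path_space :: "'e topology \<Rightarrow> ('e \<Rightarrow> 'b) \<Rightarrow> (real \<Rightarrow> 'e) topology"
  where "fibre_path_space E p =
    subtopology (path_space E) {\<gamma>. \<forall>s\<in>{0..1}. \<forall>t\<in>{0..1}. p (\<gamma> s) = p (\<gamma> t)}"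

definition path_evaluation :: "nat \<Rightarrow> (real \<Rightarrow> 'e) \<Rightarrow> nat \<Rightarrow> 'e"
  where "path_evaluation n \<gamma> = restrict (\<lambda>i. \<gamma> (real i / (real n - 1))) {..<n}"

text \<open>The infimum in \<^typ>\<open>enat\<close> is the least element, and \<open>\<infinity>\<close> for the empty set.\<close>

definition sequential_parametrized_TC :: "nat \<Rightarrow> 'e topology \<Rightarrow> ('e \<Rightarrow> 'b) \<Rightarrow> enat"
  where "sequential_parametrized_TC n E p =
    Inf {enat r | r. \<exists>U :: nat \<Rightarrow> (nat \<Rightarrow> 'e) set.
      (\<forall>i\<le>r. openin (fibre_power n E p) (U i)) \<and>
      (\<Union>i\<le>r. U i) = topspace (fibre_power n E p) \<and>
      (\<forall>i\<le>r. \<exists>s. continuous_map (subtopology (fibre_power n E p) (U i)) (fibre_path_space E p) s \<and>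
        (\<forall>e\<in>U i. path_evaluation n (s e) = e))}"

end

theory Submission
  imports Defs
begin

text \<open>Over an open set \<open>U\<close>, the path fibration has a section iff the coordinate projections
  \<open>U \<rightarrow> E\<close> are all homotopic through maps over the base. A map of fibrations carries such vertical
  homotopies forward. Conversely they can be cancelled along a self-map \<open>m\<close> of a fibration covering
  \<open>m'\<close> when both are homotopic to the identity: lifting the homotopy from \<open>m'\<close> to the identity
  replaces \<open>m\<close> by a map over the base that is homotopic to the identity, and such a map has a
  vertical left homotopy inverse. Since \<open>p \<circ> g' \<simeq> g \<circ> q\<close> for homotopy inverses \<open>g'\<close>
  of \<open>f'\<close> and \<open>g\<close> of \<open>f\<close>, the homotopy lifting property deforms \<open>g'\<close> to a map \<open>\<phi>\<close>
  with \<open>p \<circ> \<phi> = g \<circ> q\<close>. Cancelling along \<open>\<phi> \<circ> f'\<close> and \<open>f' \<circ> \<phi>\<close> shows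
  that a cover pulled back along \<open>f'\<close> or \<open>\<phi>\<close> still admits sections.\<close>

section \<open>Vertical homotopies\<close>

text \<open>Fixing the common projection \<open>b\<close> makes verticality a condition on each
  single stage, so symmetry and transitivity of \<open>homotopic_with\<close> apply
  directly.\<close>

abbreviation homotopic_over ::
  "('x \<Rightarrow> 'y) \<Rightarrow> ('w \<Rightarrow> 'y) \<Rightarrow> 'w topology \<Rightarrow> 'x topology \<Rightarrow> ('w \<Rightarrow> 'x) \<Rightarrow> ('w \<Rightarrow> 'x) \<Rightarrow> bool"
  where "homotopic_over q b W X \<equiv> homotopic_with (\<lambda>g. \<forall>w\<in>topspace W. q (g w) = b w) W X"

text \<open>The condition on the stages sees only values on \<open>topspace W\<close>, so a homotopy
  has to match its endpoints only there.\<close>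

lemma homotopic_over_iff:
  "homotopic_over q b W X a a' \<longleftrightarrow>
    (\<exists>h. continuous_map (prod_topology unit_interval W) X h \<and>
      (\<forall>w\<in>topspace W. h (0, w) = a w) \<and> (\<forall>w\<in>topspace W. h (1, w) = a' w) \<and>
      (\<forall>t\<in>{0..1}. \<forall>w\<in>topspace W. q (h (t, w)) = b w))"
  by (rule homotopic_with) auto

lemma homotopic_overI:
  assumes "continuous_map (prod_topology unit_interval W) X h"
    and "\<And>w. w \<in> topspace W \<Longrightarrow> h (0, w) = a w"
    and "\<And>w. w \<in> topspace W \<Longrightarrow> h (1, w) = a' w"
    and "\<And>t w. \<lbrakk>t \<in> {0..1}; w \<in> topspace W\<rbrakk> \<Longrightarrow> q (h (t, w)) = b w"
  shows "homotopic_over q b W X a a'"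
  unfolding homotopic_over_iff using assms by blast

lemma homotopic_over_cong:
  assumes "homotopic_over q b W X a a'"
    and "\<And>w. w \<in> topspace W \<Longrightarrow> b w = b' w"
    and "\<And>w. w \<in> topspace W \<Longrightarrow> a w = c w"
    and "\<And>w. w \<in> topspace W \<Longrightarrow> a' w = c' w"
  shows "homotopic_over q b' W X c c'"
  using assms unfolding homotopic_over_iff by (elim ex_forward) simp

text \<open>With \<open>u\<close> real-valued, a change of time is proved continuous by plain
  arithmetic, and its range is a separate condition.\<close>

lemma continuous_map_homotopy_reparam:
  assumes "continuous_map (prod_topology unit_interval W) X h"
    and "continuous_map Z euclideanreal u" and "\<And>z. z \<in> topspace Z \<Longrightarrow> u z \<in> {0..1}"
    and "continuous_map Z W v"
  shows "continuous_map Z X (\<lambda>z. h (u z, v z))"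
proof -
  have "continuous_map Z (prod_topology unit_interval W) (\<lambda>z. (u z, v z))"
    using assms by (intro continuous_map_pairedI continuous_map_into_subtopology) auto
  from continuous_map_compose[OF this assms(1)] show ?thesis
    by (simp add: o_def)
qed

lemma continuous_map_fst_unit_interval [continuous_intros]:
  "continuous_map (prod_topology unit_interval W) euclideanreal fst"
  using continuous_map_fst continuous_map_into_fulltopology by blast

section \<open>Lifting homotopies through a fibration\<close>

text \<open>For each \<open>w\<close>, \<open>q \<circ> C\<close> is a loop at \<open>b w\<close>,
  and \<open>D\<close> contracts it with endpoints fixed. Lifting \<open>D\<close> from
  \<open>C\<close> gives a square; its three sides other than \<open>C\<close> lie over
  \<open>b\<close> and together join the ends of \<open>C\<close>.\<close>

lemma homotopic_over_if_null_homotopic: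
  assumes q: "homotopy_lifting_property (prod_topology unit_interval W) X Y q"
    and C: "continuous_map (prod_topology unit_interval W) X C"
    and D: "continuous_map (prod_topology unit_interval (prod_topology unit_interval W)) Y D"
    and D0: "\<And>s w. \<lbrakk>s \<in> {0..1}; w \<in> topspace W\<rbrakk> \<Longrightarrow> D (0, s, w) = q (C (s, w))"
    and D1: "\<And>s w. \<lbrakk>s \<in> {0..1}; w \<in> topspace W\<rbrakk> \<Longrightarrow> D (1, s, w) = b w"
    and Dt: "\<And>t w. \<lbrakk>t \<in> {0..1}; w \<in> topspace W\<rbrakk> \<Longrightarrow> D (t, 0, w) = b w \<and> D (t, 1, w) = b w"
  shows "homotopic_over q b W X (\<lambda>w. C (0, w)) (\<lambda>w. C (1, w))"
proof -
  let ?I = "prod_topology unit_interval W"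
  obtain L where L: "continuous_map (prod_topology unit_interval ?I) X L"
    and L0: "\<And>s w. \<lbrakk>s \<in> {0..1}; w \<in> topspace W\<rbrakk> \<Longrightarrow> L (0, s, w) = C (s, w)"
    and qL: "\<And>t s w. \<lbrakk>t \<in> {0..1}; s \<in> {0..1}; w \<in> topspace W\<rbrakk> \<Longrightarrow> q (L (t, s, w)) = D (t, s, w)"
    using q[unfolded homotopy_lifting_property_def, rule_format, of D C] C D D0
    by (auto simp: Ball_def)
  have side: "homotopic_over q b W X (\<lambda>w. C (s, w)) (\<lambda>w. L (1, s, w))" if s: "s = 0 \<or> s = 1" for s
  proof (rule homotopic_overI)
    show "continuous_map ?I X (\<lambda>z. L (fst z, (s, snd z)))"
      using s
      by (intro continuous_map_homotopy_reparam[OF L] continuous_map_pairedI continuous_map_snd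
          continuous_map_fst_unit_interval) auto
  qed (use s in \<open>auto simp: L0 qL Dt\<close>)
  have "homotopic_over q b W X (\<lambda>w. L (1, 0, w)) (\<lambda>w. L (1, 1, w))"
  proof (rule homotopic_overI)
    show "continuous_map ?I X (\<lambda>z. L (1, (fst z, snd z)))"
      by (intro continuous_map_homotopy_reparam[OF L]) auto
  qed (auto simp: qL D1)
  then show ?thesis
    using homotopic_with_trans side[of 0] side[of 1] homotopic_with_symD by blast
qed

text \<open>Running \<open>A\<close> backwards and then \<open>A'\<close> forwards joins the two
  ends. The projection of this path retraces itself, hence contracts with endpoints fixed.\<close>

lemma homotopic_over_lifts_with_same_start:
  assumes q: "fibration X Y q"
    and A: "continuous_map (prod_topology unit_interval W) X A"
    and A': "continuous_map (prod_topology unit_interval W) X A'"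
    and start: "\<And>w. w \<in> topspace W \<Longrightarrow> A (0, w) = A' (0, w)"
    and over: "\<And>t w. \<lbrakk>t \<in> {0..1}; w \<in> topspace W\<rbrakk> \<Longrightarrow> q (A' (t, w)) = q (A (t, w))"
  shows "homotopic_over q (\<lambda>w. q (A (1, w))) W X (\<lambda>w. A (1, w)) (\<lambda>w. A' (1, w))"
proof -
  let ?I = "prod_topology unit_interval W"
  define C where "C = (\<lambda>z. if fst z \<le> 1/2 then A (1 - 2 * fst z, snd z) else A' (2 * fst z - 1, snd z))"
  have qX: "continuous_map X Y q"
    using q by (simp add: fibration_def)
  have "homotopic_over q (\<lambda>w. q (A (1, w))) W X (\<lambda>w. C (0, w)) (\<lambda>w. C (1, w))"
  proof (rule homotopic_over_if_null_homotopic)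
    show "homotopy_lifting_property ?I X Y q"
      using q by (rule fibration_imp_homotopy_lifting_property)
    show "continuous_map ?I X C"
      unfolding C_def
    proof (rule continuous_map_cases_le)
      show "continuous_map (subtopology ?I {z \<in> topspace ?I. fst z \<le> 1/2}) X
          (\<lambda>z. A (1 - 2 * fst z, snd z))"
        by (intro continuous_map_homotopy_reparam[OF A] continuous_intros
            continuous_map_from_subtopology continuous_map_snd) auto
      show "continuous_map (subtopology ?I {z \<in> topspace ?I. 1/2 \<le> fst z}) X
          (\<lambda>z. A' (2 * fst z - 1, snd z))"
        by (intro continuous_map_homotopy_reparam[OF A'] continuous_intros
            continuous_map_from_subtopology continuous_map_snd) auto
      \<comment> \<open>At the midpoint both halves are at time 0, where \<open>start\<close> makes
        them agree.\<close>
      show "A (1 - 2 * fst z, snd z) = A' (2 * fst z - 1, snd z)"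
        if "z \<in> topspace ?I" "fst z = 1/2" for z
      proof -
        have "A (0, snd z) = A' (0, snd z)"
          using that(1) by (metis start mem_Times_iff topspace_prod_topology)
        then show ?thesis
          unfolding that(2) by simp
      qed
    qed (auto intro: continuous_intros)
    \<comment> \<open>The projected path visits time \<open>\<bar>1 - 2 * s\<bar>\<close>. Replacing
      this by its maximum with \<open>t\<close> makes it turn back earlier, until at
      \<open>t = 1\<close> it rests at time 1; at \<open>s = 0\<close> and \<open>s = 1\<close> the
      time is always 1.\<close>
    have "continuous_map (prod_topology unit_interval ?I) X
        (\<lambda>z. A (max (fst z) \<bar>1 - 2 * fst (snd z)\<bar>, snd (snd z)))"
    proof (rule continuous_map_homotopy_reparam[OF A])
      have "continuous_map (prod_topology unit_interval ?I) euclideanreal (fst \<circ> snd)"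
        by (rule continuous_map_compose[OF continuous_map_snd continuous_map_fst_unit_interval])
      then show "continuous_map (prod_topology unit_interval ?I) euclideanreal
          (\<lambda>z. max (fst z) \<bar>1 - 2 * fst (snd z)\<bar>)"
        unfolding o_def by (intro continuous_intros)
      show "continuous_map (prod_topology unit_interval ?I) W (\<lambda>z. snd (snd z))"
        using continuous_map_compose[OF continuous_map_snd continuous_map_snd]
        by (simp add: o_def)
    qed auto
    from continuous_map_compose[OF this qX]
    show "continuous_map (prod_topology unit_interval ?I) Y
        (\<lambda>z. q (A (max (fst z) \<bar>1 - 2 * fst (snd z)\<bar>, snd (snd z))))"
      by (simp add: o_def)
  qed (auto simp: C_def over abs_if max_def)
  then show ?thesis
    by (simp add: C_def)
qed

text \<open>Lift the homotopy \<open>q \<circ> A\<close>, taken constant in \<open>s\<close>,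
  starting from the vertical homotopy \<open>G\<close> between the initial maps. The end of the lift
  is vertical, and its edges \<open>s = 0\<close> and \<open>s = 1\<close> share their starts with
  \<open>A\<close> and \<open>A'\<close>, so their ends can be compared.\<close>

lemma homotopic_over_transport:
  assumes q: "fibration X Y q"
    and A: "continuous_map (prod_topology unit_interval W) X A"
    and A': "continuous_map (prod_topology unit_interval W) X A'"
    and over: "\<And>t w. \<lbrakk>t \<in> {0..1}; w \<in> topspace W\<rbrakk> \<Longrightarrow> q (A' (t, w)) = q (A (t, w))"
    and start: "homotopic_over q b W X (\<lambda>w. A (0, w)) (\<lambda>w. A' (0, w))"
  shows "homotopic_over q (\<lambda>w. q (A (1, w))) W X (\<lambda>w. A (1, w)) (\<lambda>w. A' (1, w))"
proof -
  let ?I = "prod_topology unit_interval W"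
  obtain G where G: "continuous_map ?I X G"
    and G0: "\<And>w. w \<in> topspace W \<Longrightarrow> G (0, w) = A (0, w)"
    and G1: "\<And>w. w \<in> topspace W \<Longrightarrow> G (1, w) = A' (0, w)"
    and qG: "\<And>s w. \<lbrakk>s \<in> {0..1}; w \<in> topspace W\<rbrakk> \<Longrightarrow> q (G (s, w)) = b w"
    using start unfolding homotopic_over_iff by blast
  \<comment> \<open>Evaluating at \<open>s = 0\<close> identifies \<open>b\<close> with the
    projection of \<open>A (0, w)\<close>, so \<open>G\<close> is an admissible start for the
    lift.\<close>
  have "q (G (s, w)) = q (A (0, w))" if "s \<in> {0..1}" "w \<in> topspace W" for s w
    using qG[OF that] qG[of 0 w] G0 that by simp
  moreover have qX: "continuous_map X Y q"
    using q by (simp add: fibration_def)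
  have "continuous_map (prod_topology unit_interval ?I) X (\<lambda>z. A (fst z, snd (snd z)))"
    using continuous_map_compose[OF continuous_map_snd continuous_map_snd]
    by (intro continuous_map_homotopy_reparam[OF A] continuous_intros) (auto simp: o_def)
  from continuous_map_compose[OF this qX]
  have "continuous_map (prod_topology unit_interval ?I) Y (\<lambda>z. q (A (fst z, snd (snd z))))"
    by (simp add: o_def)
  ultimately obtain L where L: "continuous_map (prod_topology unit_interval ?I) X L"
    and L0: "\<And>s w. \<lbrakk>s \<in> {0..1}; w \<in> topspace W\<rbrakk> \<Longrightarrow> L (0, s, w) = G (s, w)"
    and qL: "\<And>t s w. \<lbrakk>t \<in> {0..1}; s \<in> {0..1}; w \<in> topspace W\<rbrakk> \<Longrightarrow> q (L (t, s, w)) = q (A (t, w))"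
    using fibration_imp_homotopy_lifting_property[OF q, of ?I,
        unfolded homotopy_lifting_property_def, rule_format,
        of "\<lambda>z. q (A (fst z, snd (snd z)))" G] G
    by (auto simp: Ball_def)
  have Ls: "continuous_map ?I X (\<lambda>z. L (fst z, s, snd z))" if "s \<in> {0..1}" for s
    using that
    by (intro continuous_map_homotopy_reparam[OF L] continuous_map_pairedI continuous_map_snd
        continuous_map_fst_unit_interval) auto
  have "homotopic_over q (\<lambda>w. q (A (1, w))) W X (\<lambda>w. A (1, w)) (\<lambda>w. L (1, 0, w))"
    using homotopic_over_lifts_with_same_start[OF q A Ls[of 0]] by (simp add: L0 G0 qL)
  moreover have "homotopic_over q (\<lambda>w. q (A (1, w))) W X (\<lambda>w. L (1, 0, w)) (\<lambda>w. L (1, 1, w))"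
  proof (rule homotopic_overI)
    show "continuous_map ?I X (\<lambda>z. L (1, (fst z, snd z)))"
      by (intro continuous_map_homotopy_reparam[OF L]) auto
  qed (auto simp: qL)
  moreover have "homotopic_over q (\<lambda>w. q (A (1, w))) W X (\<lambda>w. A' (1, w)) (\<lambda>w. L (1, 1, w))"
    using homotopic_over_lifts_with_same_start[OF q A' Ls[of 1]]
    by (rule homotopic_over_cong) (simp_all add: L0 G1 qL over)
  ultimately show ?thesis
    using homotopic_with_trans homotopic_with_symD by blast
qed

text \<open>This is Dold's theorem for a self-map over the base. The inverse \<open>\<rho>\<close> is the end of a lift
  \<open>J\<close>, starting at the identity, of the base homotopy \<open>q \<circ> H\<close>, where \<open>H\<close> deforms \<open>\<psi>\<close> to the
  identity. As \<open>q (H (t, x)) = q (J (t, x)) = q (J (1, H (t, x)))\<close>, the homotopies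
  \<open>J (1, H (t, x))\<close> and \<open>J (t, x)\<close> lift the same homotopy, and both end at \<open>\<rho>\<close>.\<close>

lemma fibre_homotopy_left_inverse:
  assumes q: "fibration X Y q" and \<psi>: "continuous_map X X \<psi>"
    and q\<psi>: "\<And>x. x \<in> topspace X \<Longrightarrow> q (\<psi> x) = q x"
    and \<psi>id: "homotopic_with (\<lambda>x. True) X X \<psi> id"
  obtains \<rho> where "continuous_map X X \<rho>" and "\<And>x. x \<in> topspace X \<Longrightarrow> q (\<rho> x) = q x"
    and "homotopic_over q q X X (\<rho> \<circ> \<psi>) id"
proof -
  let ?I = "prod_topology unit_interval X"
  obtain H where H: "continuous_map ?I X H"
    and H0: "\<And>x. H (0, x) = \<psi> x" and H1: "\<And>x. H (1, x) = x"
    using \<psi>id by (auto simp: homotopic_with_def)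
  have HX: "H (t, x) \<in> topspace X" if "t \<in> {0..1}" "x \<in> topspace X" for t x
    using H that by (auto simp: continuous_map_def)
  have qX: "continuous_map X Y q"
    using q by (simp add: fibration_def)
  \<comment> \<open>The identity is an admissible start because
    \<open>q (H (0, x)) = q (\<psi> x) = q x\<close>.\<close>
  obtain J where J: "continuous_map ?I X J"
    and J0: "\<And>x. x \<in> topspace X \<Longrightarrow> J (0, x) = x"
    and qJ: "\<And>t x. \<lbrakk>t \<in> {0..1}; x \<in> topspace X\<rbrakk> \<Longrightarrow> q (J (t, x)) = q (H (t, x))"
    using fibration_imp_homotopy_lifting_property[OF q, of X,
        unfolded homotopy_lifting_property_def, rule_format, of "q \<circ> H" id]
      continuous_map_compose[OF H qX] by (auto simp: H0 q\<psi> Ball_def)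
  define \<rho> where "\<rho> x = J (1, x)" for x
  have \<rho>: "continuous_map X X \<rho>"
    unfolding \<rho>_def by (intro continuous_map_homotopy_reparam[OF J]) auto
  have q\<rho>: "q (\<rho> x) = q x" if "x \<in> topspace X" for x
    using that by (simp add: \<rho>_def qJ H1)
  \<comment> \<open>Reversing time turns the common end \<open>\<rho>\<close> into the common start
    that the comparison of lifts requires.\<close>
  have A: "continuous_map ?I X (\<lambda>z. J (1 - fst z, snd z))"
    by (intro continuous_map_homotopy_reparam[OF J] continuous_intros continuous_map_snd) auto
  have "continuous_map ?I X (\<lambda>z. H (1 - fst z, snd z))"
    by (intro continuous_map_homotopy_reparam[OF H] continuous_intros continuous_map_snd) auto
  from continuous_map_compose[OF this \<rho>]
  have A': "continuous_map ?I X (\<lambda>z. \<rho> (H (1 - fst z, snd z)))"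
    by (simp add: o_def)
  have "homotopic_over q q X X id (\<rho> \<circ> \<psi>)"
    using homotopic_over_lifts_with_same_start[OF q A A']
    by (rule homotopic_over_cong) (simp_all add: \<rho>_def[symmetric] H0 H1 J0 q\<rho> HX qJ)
  with \<rho> q\<rho> show ?thesis
    using that homotopic_with_symD by blast
qed

text \<open>A lift \<open>M\<close> of the homotopy from \<open>m'\<close> to the identity ends at a
  vertical map \<open>\<psi>\<close>. Transport along \<open>M\<close> turns the given homotopy into
  a vertical one from \<open>\<psi> \<circ> a\<close> to \<open>\<psi> \<circ> a'\<close>, and a
  vertical left inverse of \<open>\<psi>\<close> then removes \<open>\<psi>\<close>.\<close>

lemma homotopic_over_cancel:
  assumes q: "fibration X Y q" and m: "continuous_map X X m"
    and qm: "\<And>x. x \<in> topspace X \<Longrightarrow> q (m x) = m' (q x)"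
    and mid: "homotopic_with (\<lambda>x. True) X X m id"
    and m'id: "homotopic_with (\<lambda>x. True) Y Y m' id"
    and a: "continuous_map W X a" and a': "continuous_map W X a'"
    and qa: "\<And>w. w \<in> topspace W \<Longrightarrow> q (a' w) = q (a w)"
    and ma: "homotopic_over q b W X (m \<circ> a) (m \<circ> a')"
  shows "homotopic_over q (q \<circ> a) W X a a'"
proof -
  have aX: "a w \<in> topspace X" "a' w \<in> topspace X" if "w \<in> topspace W" for w
    using a a' that by (auto simp: continuous_map_def)
  have qX: "continuous_map X Y q"
    using q by (simp add: fibration_def)
  obtain k where k: "continuous_map (prod_topology unit_interval Y) Y k"
    and k0: "\<And>y. k (0, y) = m' y" and k1: "\<And>y. k (1, y) = y"
    using m'id by (auto simp: homotopic_with_def)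
  have "continuous_map (prod_topology unit_interval X) Y (\<lambda>z. k (fst z, q (snd z)))"
    using continuous_map_compose[OF continuous_map_snd qX]
    by (intro continuous_map_homotopy_reparam[OF k] continuous_intros) (auto simp: o_def)
  then obtain M where M: "continuous_map (prod_topology unit_interval X) X M"
    and M0: "\<And>x. x \<in> topspace X \<Longrightarrow> M (0, x) = m x"
    and qM: "\<And>t x. \<lbrakk>t \<in> {0..1}; x \<in> topspace X\<rbrakk> \<Longrightarrow> q (M (t, x)) = k (t, q x)"
    using fibration_imp_homotopy_lifting_property[OF q, of X,
        unfolded homotopy_lifting_property_def, rule_format, of "\<lambda>z. k (fst z, q (snd z))" m] m
    by (auto simp: k0 qm Ball_def)
  define \<psi> where "\<psi> x = M (1, x)" for x
  have \<psi>: "continuous_map X X \<psi>"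
    unfolding \<psi>_def by (intro continuous_map_homotopy_reparam[OF M]) auto
  have q\<psi>: "q (\<psi> x) = q x" if "x \<in> topspace X" for x
    using that by (simp add: \<psi>_def qM k1)
  \<comment> \<open>\<open>M\<close> itself need not be vertical; it only shows that
    \<open>\<psi>\<close> inherits from \<open>m\<close> a homotopy to the identity.\<close>
  have "homotopic_with (\<lambda>x. True) X X m \<psi>"
    using M by (subst homotopic_with) (auto simp: M0 \<psi>_def)
  then have "homotopic_with (\<lambda>x. True) X X \<psi> id"
    using mid homotopic_with_symD homotopic_with_trans by blast
  then obtain \<rho> where \<rho>: "continuous_map X X \<rho>"
    and q\<rho>: "\<And>x. x \<in> topspace X \<Longrightarrow> q (\<rho> x) = q x"
    and \<rho>\<psi>: "homotopic_over q q X X (\<rho> \<circ> \<psi>) id"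
    using fibre_homotopy_left_inverse[OF q \<psi> q\<psi>] by blast
  have Ma: "continuous_map (prod_topology unit_interval W) X (\<lambda>z. M (fst z, c (snd z)))"
    if "continuous_map W X c" for c
    using continuous_map_compose[OF continuous_map_snd that]
    by (intro continuous_map_homotopy_reparam[OF M] continuous_intros) (auto simp: o_def)
  have "homotopic_over q (q \<circ> a) W X (\<psi> \<circ> a) (\<psi> \<circ> a')"
  proof -
    have start: "homotopic_over q b W X
        (\<lambda>w. M (fst (0, w), a (snd (0, w)))) (\<lambda>w. M (fst (0, w), a' (snd (0, w))))"
      using ma by (rule homotopic_over_cong) (simp_all add: M0 aX)
    show ?thesis
      \<comment> \<open>By \<open>qa\<close>, both \<open>M (t, a w)\<close> and
        \<open>M (t, a' w)\<close> lie over \<open>k (t, q (a w))\<close>.\<close>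
      using homotopic_over_transport[OF q Ma[OF a] Ma[OF a'] _ start]
      by (rule homotopic_over_cong) (simp_all add: \<psi>_def qM k1 aX qa)
  qed
  then obtain h where h: "continuous_map (prod_topology unit_interval W) X h"
    and h0: "\<And>w. w \<in> topspace W \<Longrightarrow> h (0, w) = \<psi> (a w)"
    and h1: "\<And>w. w \<in> topspace W \<Longrightarrow> h (1, w) = \<psi> (a' w)"
    and qh: "\<And>t w. \<lbrakk>t \<in> {0..1}; w \<in> topspace W\<rbrakk> \<Longrightarrow> q (h (t, w)) = q (a w)"
    unfolding homotopic_over_iff by auto
  have hX: "h (t, w) \<in> topspace X" if "t \<in> {0..1}" "w \<in> topspace W" for t w
    using h that by (auto simp: continuous_map_def)
  have "homotopic_over q (q \<circ> a) W X (\<rho> \<circ> \<psi> \<circ> a) (\<rho> \<circ> \<psi> \<circ> a')"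
    using continuous_map_compose[OF h \<rho>]
    by (rule homotopic_overI) (simp_all add: h0 h1 qh q\<rho> hX)
  moreover
  have "homotopic_over q (q \<circ> a) W X (\<rho> \<circ> \<psi> \<circ> c) (id \<circ> c)"
    if "c = a \<or> c = a'" for c
  proof (rule homotopic_with_compose_continuous_map_right[OF \<rho>\<psi>])
    show "continuous_map W X c"
      using that a a' by blast
    show "\<forall>w\<in>topspace W. q ((j \<circ> c) w) = (q \<circ> a) w" if "\<forall>x\<in>topspace X. q (j x) = q x" for j
      using that \<open>c = a \<or> c = a'\<close> by (auto simp: aX qa)
  qed
  from this[of a] this[of a']
  have "homotopic_over q (q \<circ> a) W X (\<rho> \<circ> \<psi> \<circ> a) a"
    and "homotopic_over q (q \<circ> a) W X (\<rho> \<circ> \<psi> \<circ> a') a'"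
    by simp_all
  ultimately show ?thesis
    using homotopic_with_trans homotopic_with_symD by blast
qed

section \<open>Sections of the path fibration\<close>

text \<open>The section clause of \<open>sequential_parametrized_TC_def\<close> verbatim, so that it
  can be folded there.\<close>

definition has_path_section :: "nat \<Rightarrow> 'e topology \<Rightarrow> ('e \<Rightarrow> 'b) \<Rightarrow> (nat \<Rightarrow> 'e) set \<Rightarrow> bool"
  where "has_path_section n E p U \<longleftrightarrow>
    (\<exists>s. continuous_map (subtopology (fibre_power n E p) U) (fibre_path_space E p) s \<and>
      (\<forall>e\<in>U. path_evaluation n (s e) = e))"

lemma topspace_fibre_power:
  "topspace (fibre_power n E p) =
    {e \<in> {..<n} \<rightarrow>\<^sub>E topspace E. \<forall>i<n. \<forall>j<n. p (e i) = p (e j)}"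
  by (auto simp: fibre_power_def)

lemma fibre_power_component:
  assumes "e \<in> topspace (fibre_power n E p)" and "i < n"
  shows "e i \<in> topspace E"
  using assms by (simp add: topspace_fibre_power PiE_iff)

lemma fibre_power_same_fibre:
  assumes "e \<in> topspace (fibre_power n E p)" and "i < n" and "j < n"
  shows "p (e i) = p (e j)"
  using assms unfolding topspace_fibre_power by blast

lemma continuous_map_fibre_power_component:
  assumes "i < n"
  shows "continuous_map (subtopology (fibre_power n E p) U) E (\<lambda>e. e i)"
  unfolding fibre_power_def
  using assms by (intro continuous_map_from_subtopology continuous_map_product_projection) simp

lemma continuous_map_fibre_power_map:
  assumes F: "continuous_map E X F" and qF: "\<And>e. e \<in> topspace E \<Longrightarrow> q (F e) = f (p e)"
  shows "continuous_map (fibre_power n E p) (fibre_power n X q) (\<lambda>e. \<lambda>i\<in>{..<n}. F (e i))"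
proof -
  have "continuous_map (fibre_power n E p) X (\<lambda>e. F (e i))" if "i < n" for i
    using continuous_map_compose[OF continuous_map_fibre_power_component[OF that, of E p UNIV] F]
    by (simp add: o_def)
  then have "continuous_map (fibre_power n E p) (product_topology (\<lambda>i. X) {..<n})
      (\<lambda>e. \<lambda>i\<in>{..<n}. F (e i))"
    by (subst continuous_map_componentwise) auto
  moreover have "q ((\<lambda>i\<in>{..<n}. F (e i)) i) = q ((\<lambda>i\<in>{..<n}. F (e i)) j)"
    if "e \<in> topspace (fibre_power n E p)" "i < n" "j < n" for e i j
    using fibre_power_same_fibre[OF that] fibre_power_component[OF that(1)] that(2,3)
    by (simp add: qF)
  ultimately show ?thesis
    unfolding fibre_power_def[of n X q]
    by (intro continuous_map_into_subtopology funcsetI CollectI allI impI)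
qed

text \<open>The section assigns to \<open>e\<close> a path in one fibre that starts at
  \<open>e 0\<close> and later meets \<open>e i\<close>; sliding along it is the homotopy, jointly
  continuous by path evaluation.\<close>

lemma homotopic_over_projections_if_has_path_section:
  fixes p :: "'e \<Rightarrow> 'b"
  assumes n: "n \<ge> 2" and U: "U \<subseteq> topspace (fibre_power n E p)"
    and sec: "has_path_section n E p U" and i: "i < n"
  shows "homotopic_over p (\<lambda>e. p (e 0)) (subtopology (fibre_power n E p) U) E (\<lambda>e. e 0) (\<lambda>e. e i)"
proof -
  let ?W = "subtopology (fibre_power n E p) U"
  have W: "topspace ?W = U"
    using U by auto
  obtain s where s: "continuous_map ?W (fibre_path_space E p) s"
    and eval: "\<And>e. e \<in> U \<Longrightarrow> path_evaluation n (s e) = e"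
    using sec by (auto simp: has_path_section_def)
  \<comment> \<open>The time at which the path meets coordinate \<open>i\<close>;
    \<open>n \<ge> 2\<close> makes the denominator positive.\<close>
  define c where "c = real i / (real n - 1)"
  have c: "0 \<le> c" "c \<le> 1"
    using n i by (auto simp: c_def field_simps)
  have s_path: "continuous_map ?W (path_space E) s"
    using s unfolding fibre_path_space_def by (rule continuous_map_into_fulltopology)
  have s_fibre: "p (s e t) = p (s e t')" if "e \<in> U" "t \<in> {0..1}" "t' \<in> {0..1}" for e t t'
    using s that W unfolding fibre_path_space_def continuous_map_in_subtopology by blast
  have s0: "s e 0 = e 0" and sc: "s e c = e i" if "e \<in> U" for e
    using n i fun_cong[OF eval[OF that], of 0] fun_cong[OF eval[OF that], of i]
    by (auto simp: path_evaluation_def c_def)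
  show ?thesis
  proof (rule homotopic_overI)
    have "continuous_map (prod_topology unit_interval ?W) (path_space E) (\<lambda>z. s (snd z))"
      using continuous_map_compose[OF continuous_map_snd s_path] by (simp add: o_def)
    moreover have "fst z * c \<in> {0..1}" if "z \<in> topspace (prod_topology unit_interval ?W)" for z
      using that c by (auto intro: mult_le_one)
    moreover have "continuous_map (prod_topology unit_interval ?W) euclideanreal (\<lambda>z. fst z * c)"
      by (intro continuous_intros)
    ultimately have "continuous_map (prod_topology unit_interval ?W) E
        (\<lambda>z. case (fst z * c, s (snd z)) of (t, \<beta>) \<Rightarrow> \<beta> t)"
      by (intro continuous_map_homotopy_reparam[OF continuous_map_path_eval])
    then show "continuous_map (prod_topology unit_interval ?W) E (\<lambda>z. s (snd z) (fst z * c))"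
      by simp
    show "p (s (snd (t, e)) (fst (t, e) * c)) = p (e 0)"
      if "t \<in> {0..1}" "e \<in> topspace ?W" for t e
      using s_fibre[of e "t * c" 0] that c unfolding W by (auto simp: s0 intro: mult_le_one)
  qed (use W in \<open>auto simp: s0 sc\<close>)
qed

text \<open>Letting time run over the whole real line, with \<open>a i\<close> reached at time
  \<open>i\<close>, allows one homotopy after another to be appended without rescaling.\<close>

lemma concatenate_homotopies:
  assumes a: "\<And>i. i \<le> m \<Longrightarrow> homotopic_over p b W E (a 0) (a i)"
  shows "\<exists>S. continuous_map (prod_topology euclideanreal W) E S \<and>
    (\<forall>i\<le>m. \<forall>w\<in>topspace W. S (real i, w) = a i w) \<and>
    (\<forall>t. \<forall>w\<in>topspace W. p (S (t, w)) = b w)"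
  using a
proof (induction m)
  case 0
  \<comment> \<open>The case \<open>i = 0\<close> records that \<open>a 0\<close> is continuous and
    lies over \<open>b\<close>, so it can serve as a constant homotopy.\<close>
  then have "homotopic_over p b W E (a 0) (a 0)"
    by blast
  then have "continuous_map W E (a 0)" "\<forall>w\<in>topspace W. p (a 0 w) = b w"
    by simp_all
  then show ?case
    by (intro exI[of _ "a 0 \<circ> snd"]) (simp add: continuous_map_of_snd del: o_apply, simp)
next
  case (Suc m)
  let ?R = "prod_topology euclideanreal W"
  obtain S where S: "continuous_map ?R E S"
    and Sa: "\<And>i w. \<lbrakk>i \<le> m; w \<in> topspace W\<rbrakk> \<Longrightarrow> S (real i, w) = a i w"
    and pS: "\<And>t w. w \<in> topspace W \<Longrightarrow> p (S (t, w)) = b w"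
    using Suc by force
  \<comment> \<open>Consecutive maps are joined by way of \<open>a 0\<close>.\<close>
  have "homotopic_over p b W E (a m) (a (Suc m))"
    by (rule homotopic_with_trans[OF homotopic_with_symD]) (rule Suc.prems; simp)+
  then obtain h where h: "continuous_map (prod_topology unit_interval W) E h"
    and h0: "\<And>w. w \<in> topspace W \<Longrightarrow> h (0, w) = a m w"
    and h1: "\<And>w. w \<in> topspace W \<Longrightarrow> h (1, w) = a (Suc m) w"
    and ph: "\<And>t w. \<lbrakk>t \<in> {0..1}; w \<in> topspace W\<rbrakk> \<Longrightarrow> p (h (t, w)) = b w"
    unfolding homotopic_over_iff by auto
  \<comment> \<open>Clamping keeps the time of \<open>h\<close> in the unit interval; beyond time
    \<open>m + 1\<close> the map rests at \<open>a (Suc m)\<close>.\<close>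
  define T where "T z = (if fst z \<le> real m then S z else h (max 0 (min 1 (fst z - real m)), snd z))"
    for z
  have "continuous_map ?R E T"
    unfolding T_def
  proof (rule continuous_map_cases_le)
    show "continuous_map (subtopology ?R {z \<in> topspace ?R. real m \<le> fst z}) E
        (\<lambda>z. h (max 0 (min 1 (fst z - real m)), snd z))"
      by (intro continuous_map_homotopy_reparam[OF h] continuous_intros
          continuous_map_from_subtopology continuous_map_fst continuous_map_snd) auto
  qed (auto simp: Sa h0 intro: S continuous_map_from_subtopology continuous_map_fst)
  moreover have "T (real i, w) = a i w" if "i \<le> Suc m" "w \<in> topspace W" for i w
    using that by (cases "i = Suc m") (auto simp: T_def Sa h1)
  moreover have "p (T (t, w)) = b w" if "w \<in> topspace W" for t w
    using that by (auto simp: T_def pS ph)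
  ultimately show ?case
    by blast
qed

text \<open>Concatenating the homotopies gives for each \<open>e\<close> a vertical path through all
  its coordinates, and currying turns this family into a continuous map to the path space.\<close>

lemma has_path_section_if_homotopic_over_projections:
  fixes p :: "'e \<Rightarrow> 'b"
  assumes n: "n \<ge> 2" and U: "U \<subseteq> topspace (fibre_power n E p)"
    and hom: "\<And>i. i < n \<Longrightarrow> homotopic_over p (\<lambda>e. p (e 0))
      (subtopology (fibre_power n E p) U) E (\<lambda>e. e 0) (\<lambda>e. e i)"
  shows "has_path_section n E p U"
proof -
  let ?W = "subtopology (fibre_power n E p) U"
  have W: "topspace ?W = U"
    using U by auto
  obtain S where S: "continuous_map (prod_topology euclideanreal ?W) E S"
    and Si: "\<And>i e. \<lbrakk>i \<le> n - 1; e \<in> U\<rbrakk> \<Longrightarrow> S (real i, e) = e i"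
    and pS: "\<And>t e. e \<in> U \<Longrightarrow> p (S (t, e)) = p (e 0)"
    using concatenate_homotopies[where m = "n - 1" and p = p and b = "\<lambda>e. p (e 0)" and W = ?W
        and E = E and a = "\<lambda>i e. e i"] hom n W by force
  \<comment> \<open>The scaling sends the evaluation time \<open>i / (n - 1)\<close> to
    \<open>i\<close>, where \<open>S\<close> takes the value \<open>e i\<close>.\<close>
  define s where "s e = (\<lambda>t\<in>{0..1}. S ((real n - 1) * t, e))" for e
  have "continuous_map (prod_topology unit_interval ?W) (prod_topology euclideanreal ?W)
      (\<lambda>z. ((real n - 1) * fst z, snd z))"
    by (intro continuous_map_pairedI continuous_intros continuous_map_snd)
  from continuous_map_compose[OF this S]
  have "continuous_map ?W (path_space E) s"
    unfolding s_def
    by (intro continuous_map_path_curry[of _ _ "\<lambda>z. S ((real n - 1) * fst z, snd z)", simplified])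
      (simp add: o_def)
  moreover have "p (s e t) = p (s e t')"
    if "e \<in> topspace ?W" "t \<in> {0..1}" "t' \<in> {0..1}" for e t t'
    using that by (simp add: s_def pS)
  ultimately have "continuous_map ?W (fibre_path_space E p) s"
    unfolding fibre_path_space_def by (intro continuous_map_into_subtopology funcsetI CollectI ballI)
  moreover have "path_evaluation n (s e) = e" if e: "e \<in> U" for e
  proof
    fix i
    show "path_evaluation n (s e) i = e i"
    proof (cases "i < n")
      case True
      then have "real i / (real n - 1) \<in> {0..1}"
        using n by (auto simp: field_simps)
      then show ?thesis
        using True n Si[of i e] e by (simp add: path_evaluation_def s_def)
    next
      case False
      \<comment> \<open>Outside the index range both sides are \<open>undefined\<close>.\<close>
      moreover have "e \<in> extensional {..<n}"
        using e U by (auto simp: topspace_fibre_power PiE_def)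
      ultimately show ?thesis
        by (simp add: path_evaluation_def extensional_def)
    qed
  qed
  ultimately show ?thesis
    unfolding has_path_section_def by blast
qed

section \<open>Invariance\<close>

text \<open>A cover for \<open>X\<close> pulls back along \<open>F\<close> applied coordinatewise.
  Over a preimage, the vertical homotopies between projections in \<open>X\<close> are pulled back,
  pushed to \<open>E\<close> by \<open>G\<close>, and freed of \<open>G \<circ> F\<close> by
  cancellation.\<close>

lemma sequential_parametrized_TC_le:
  fixes E :: "'e topology" and B :: "'b topology" and X :: "'x topology"
    and p :: "'e \<Rightarrow> 'b" and q :: "'x \<Rightarrow> 'y"
  assumes n: "n \<ge> 2" and p: "fibration E B p"
    and F: "continuous_map E X F" and qF: "\<And>e. e \<in> topspace E \<Longrightarrow> q (F e) = f (p e)"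
    and G: "continuous_map X E G" and pG: "\<And>x. x \<in> topspace X \<Longrightarrow> p (G x) = g (q x)"
    and GF: "homotopic_with (\<lambda>x. True) E E (G \<circ> F) id"
    and gf: "homotopic_with (\<lambda>x. True) B B (g \<circ> f) id"
  shows "sequential_parametrized_TC n E p \<le> sequential_parametrized_TC n X q"
proof -
  let ?Fn = "\<lambda>e. \<lambda>i\<in>{..<n}. F (e i)"
  let ?EB = "fibre_power n E p" and ?XY = "fibre_power n X q"
  have FX: "F e \<in> topspace X" if "e \<in> topspace E" for e
    using F that by (auto simp: continuous_map_def)
  have Fn: "continuous_map ?EB ?XY ?Fn"
    using F qF by (rule continuous_map_fibre_power_map)
  have sec: "has_path_section n E p {e \<in> topspace ?EB. ?Fn e \<in> U}" (is "has_path_section n E p ?V")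
    if U: "openin ?XY U" "has_path_section n X q U" for U
  proof (rule has_path_section_if_homotopic_over_projections[OF n])
    fix i assume i: "i < n"
    let ?W = "subtopology ?EB ?V"
    have pe: "p (e i) = p (e 0)" if "e \<in> topspace ?W" for e
      using that i n fibre_power_same_fibre[of e n E p i 0] by simp
    have FnU: "continuous_map ?W (subtopology ?XY U) ?Fn"
      using Fn by (intro continuous_map_into_subtopology continuous_map_from_subtopology) auto
    have "homotopic_over q (\<lambda>x. q (x 0)) (subtopology ?XY U) X (\<lambda>x. x 0) (\<lambda>x. x i)"
      using homotopic_over_projections_if_has_path_section[OF n openin_subset[OF U(1)] U(2) i] .
    then obtain h where h: "continuous_map (prod_topology unit_interval (subtopology ?XY U)) X h"
      and h0: "\<And>x. x \<in> topspace (subtopology ?XY U) \<Longrightarrow> h (0, x) = x 0"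
      and h1: "\<And>x. x \<in> topspace (subtopology ?XY U) \<Longrightarrow> h (1, x) = x i"
      and qh: "\<And>t x. \<lbrakk>t \<in> {0..1}; x \<in> topspace (subtopology ?XY U)\<rbrakk> \<Longrightarrow> q (h (t, x)) = q (x 0)"
      unfolding homotopic_over_iff[where q = q] by blast
    have FnW: "?Fn e \<in> topspace (subtopology ?XY U)" if "e \<in> topspace ?W" for e
      using FnU that by (auto simp: continuous_map_def)
    have hX: "h (t, ?Fn e) \<in> topspace X" if "t \<in> {0..1}" "e \<in> topspace ?W" for t e
      using h FnW[OF that(2)] that(1) by (auto simp: continuous_map_def)
    have "homotopic_over p (\<lambda>e. g (q (F (e 0)))) ?W E (G \<circ> F \<circ> (\<lambda>e. e 0)) (G \<circ> F \<circ> (\<lambda>e. e i))"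
    proof (rule homotopic_overI)
      have "continuous_map (prod_topology unit_interval ?W) X (\<lambda>z. h (fst z, ?Fn (snd z)))"
        using continuous_map_compose[OF continuous_map_snd FnU]
        by (intro continuous_map_homotopy_reparam[OF h] continuous_intros) (auto simp: o_def)
      from continuous_map_compose[OF this G]
      show "continuous_map (prod_topology unit_interval ?W) E (\<lambda>z. G (h (fst z, ?Fn (snd z))))"
        by (simp add: o_def)
    next
      fix e assume e: "e \<in> topspace ?W"
      show "G (h (fst (0, e), ?Fn (snd (0, e)))) = (G \<circ> F \<circ> (\<lambda>e. e 0)) e"
        using h0[OF FnW[OF e]] n by simp
      show "G (h (fst (1, e), ?Fn (snd (1, e)))) = (G \<circ> F \<circ> (\<lambda>e. e i)) e"
        using h1[OF FnW[OF e]] i by simp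
    next
      fix t :: real and e assume "t \<in> {0..1}" and e: "e \<in> topspace ?W"
      then show "p (G (h (fst (t, e), ?Fn (snd (t, e))))) = g (q (F (e 0)))"
        using qh[OF _ FnW[OF e], of t] hX[of t e] n by (simp add: pG)
    qed
    then have "homotopic_over p (p \<circ> (\<lambda>e. e 0)) ?W E (\<lambda>e. e 0) (\<lambda>e. e i)"
    proof (rule homotopic_over_cancel[OF p _ _ GF gf, rotated -1])
      show "continuous_map E E (G \<circ> F)"
        using F G by (rule continuous_map_compose)
      show "p ((G \<circ> F) e) = (g \<circ> f) (p e)" if "e \<in> topspace E" for e
        using that by (simp add: pG FX qF)
    qed (use i n pe in \<open>auto intro: continuous_map_fibre_power_component\<close>)
    then show "homotopic_over p (\<lambda>e. p (e 0)) ?W E (\<lambda>e. e 0) (\<lambda>e. e i)"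
      by (simp add: o_def)
  qed auto
  show ?thesis
    unfolding sequential_parametrized_TC_def has_path_section_def[symmetric]
  \<comment> \<open>Every \<open>r\<close> admissible for \<open>X\<close> is admissible for
    \<open>E\<close>, so the infimum for \<open>E\<close> is over a larger set.\<close>
  proof (rule Inf_superset_mono, rule subsetI)
    fix c
    assume "c \<in> {enat r | r. \<exists>U. (\<forall>i\<le>r. openin ?XY (U i)) \<and> (\<Union>i\<le>r. U i) = topspace ?XY \<and>
      (\<forall>i\<le>r. has_path_section n X q (U i))}"
    then obtain r U where c: "c = enat r"
      and U: "\<And>i. i \<le> r \<Longrightarrow> openin ?XY (U i)" "(\<Union>i\<le>r. U i) = topspace ?XY"
        "\<And>i. i \<le> r \<Longrightarrow> has_path_section n X q (U i)"
      by auto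
    define V where "V i = {e \<in> topspace ?EB. ?Fn e \<in> U i}" for i
    have "openin ?EB (V i)" "has_path_section n E p (V i)" if "i \<le> r" for i
      using that U sec unfolding V_def by (auto intro: openin_continuous_map_preimage[OF Fn])
    moreover have "?Fn e \<in> topspace ?XY" if "e \<in> topspace ?EB" for e
      using Fn that by (auto simp: continuous_map_def)
    then have "(\<Union>i\<le>r. V i) = topspace ?EB"
      unfolding U(2)[symmetric] by (auto simp: V_def)
    ultimately show "c \<in> {enat r | r. \<exists>U. (\<forall>i\<le>r. openin ?EB (U i)) \<and> (\<Union>i\<le>r. U i) = topspace ?EB \<and>
      (\<forall>i\<le>r. has_path_section n E p (U i))}"
      unfolding c by blast
  qed
qed

text \<open>The square for \<open>f'\<close> gives \<open>p \<circ> g' \<simeq> g \<circ> f \<circ>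
  p \<circ> g' = g \<circ> q \<circ> f' \<circ> g' \<simeq> g \<circ> q\<close>. Lifting this
  homotopy from \<open>g'\<close> ends at a map strictly over \<open>g\<close>.\<close>

lemma strict_inverse_over:
  assumes p: "fibration E B p" and q: "continuous_map X Y q"
    and f: "continuous_map B Y f"
    and qf': "\<And>e. e \<in> topspace E \<Longrightarrow> q (f' e) = f (p e)"
    and g': "continuous_map X E g'" and g: "continuous_map Y B g"
    and f'g': "homotopic_with (\<lambda>x. True) X X (f' \<circ> g') id"
    and gf: "homotopic_with (\<lambda>x. True) B B (g \<circ> f) id"
  obtains \<phi> where "homotopic_with (\<lambda>x. True) X E g' \<phi>"
    and "\<And>x. x \<in> topspace X \<Longrightarrow> p (\<phi> x) = g (q x)"
proof -
  have pB: "continuous_map E B p"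
    using p by (simp add: fibration_def)
  have g'E: "g' x \<in> topspace E" if "x \<in> topspace X" for x
    using g' that by (auto simp: continuous_map_def)
  have "homotopic_with (\<lambda>x. True) X B (id \<circ> (p \<circ> g')) (g \<circ> f \<circ> (p \<circ> g'))"
    using homotopic_with_symD[OF gf] continuous_map_compose[OF g' pB]
    by (rule homotopic_with_compose_continuous_map_right) simp
  moreover have "homotopic_with (\<lambda>x. True) X B (g \<circ> f \<circ> (p \<circ> g')) (g \<circ> q \<circ> (f' \<circ> g'))"
    using continuous_map_compose[OF continuous_map_compose[OF g' pB] continuous_map_compose[OF f g]]
    by (intro homotopic_with_equal) (simp_all add: qf' g'E)
  moreover have "homotopic_with (\<lambda>x. True) X B (g \<circ> q \<circ> (f' \<circ> g')) (g \<circ> q \<circ> id)"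
    using f'g' continuous_map_compose[OF q g]
    by (rule homotopic_with_compose_continuous_map_left) simp
  ultimately have "homotopic_with (\<lambda>x. True) X B (p \<circ> g') (g \<circ> q)"
    using homotopic_with_trans by (simp only: id_comp comp_id) blast
  then obtain k where k: "continuous_map (prod_topology unit_interval X) B k"
    and k0: "\<And>x. k (0, x) = p (g' x)" and k1: "\<And>x. k (1, x) = g (q x)"
    by (auto simp: homotopic_with_def)
  then obtain K where K: "continuous_map (prod_topology unit_interval X) E K"
    and K0: "\<And>x. x \<in> topspace X \<Longrightarrow> K (0, x) = g' x"
    and pK: "\<And>t x. \<lbrakk>t \<in> {0..1}; x \<in> topspace X\<rbrakk> \<Longrightarrow> p (K (t, x)) = k (t, x)"
    using fibration_imp_homotopy_lifting_property[OF p, of X,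
        unfolded homotopy_lifting_property_def, rule_format, of k g'] g'
    by (auto simp: Ball_def)
  have "homotopic_with (\<lambda>x. True) X E g' (\<lambda>x. K (1, x))"
    using K by (subst homotopic_with) (auto simp: K0)
  then show ?thesis
    using that pK k1 by simp
qed

theorem proposition2p7:
  fixes n :: nat
    and E :: "'e topology" and B :: "'b topology" and p :: "'e \<Rightarrow> 'b"
    and X :: "'x topology" and Y :: "'y topology" and q :: "'x \<Rightarrow> 'y"
    and f' :: "'e \<Rightarrow> 'x" and f :: "'b \<Rightarrow> 'y"
  assumes "n \<ge> 2"
    and "fibration E B p"
    and "fibration X Y q"
    and "homotopy_equivalence_map E X f'"
    and "homotopy_equivalence_map B Y f"
    and "\<forall>e\<in>topspace E. q (f' e) = f (p e)"
  shows "sequential_parametrized_TC n E p = sequential_parametrized_TC n X q"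
proof -
  obtain g' where f': "continuous_map E X f'" and g': "continuous_map X E g'"
    and g'f': "homotopic_with (\<lambda>x. True) E E (g' \<circ> f') id"
    and f'g': "homotopic_with (\<lambda>x. True) X X (f' \<circ> g') id"
    using assms(4) by (auto simp: homotopy_equivalence_map_def)
  obtain g where f: "continuous_map B Y f" and g: "continuous_map Y B g"
    and gf: "homotopic_with (\<lambda>x. True) B B (g \<circ> f) id"
    and fg: "homotopic_with (\<lambda>x. True) Y Y (f \<circ> g) id"
    using assms(5) by (auto simp: homotopy_equivalence_map_def)
  have qY: "continuous_map X Y q"
    using assms(3) by (simp add: fibration_def)
  have qf': "q (f' e) = f (p e)" if "e \<in> topspace E" for e
    using that assms(6) by blast
  obtain \<phi> where g'\<phi>: "homotopic_with (\<lambda>x. True) X E g' \<phi>"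
    and p\<phi>: "\<And>x. x \<in> topspace X \<Longrightarrow> p (\<phi> x) = g (q x)"
    using strict_inverse_over[OF assms(2) qY f qf' g' g f'g' gf] by blast
  have \<phi>: "continuous_map X E \<phi>"
    using g'\<phi> homotopic_with_imp_continuous_maps by blast
  \<comment> \<open>Being homotopic to \<open>g'\<close>, the map \<open>\<phi>\<close> is again a
    homotopy inverse of \<open>f'\<close>.\<close>
  have "homotopic_with (\<lambda>x. True) E E (g' \<circ> f') (\<phi> \<circ> f')"
    using g'\<phi> f' by (rule homotopic_with_compose_continuous_map_right) simp
  then have \<phi>f': "homotopic_with (\<lambda>x. True) E E (\<phi> \<circ> f') id"
    using g'f' homotopic_with_symD homotopic_with_trans by blast
  have "homotopic_with (\<lambda>x. True) X X (f' \<circ> g') (f' \<circ> \<phi>)"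
    using g'\<phi> f' by (rule homotopic_with_compose_continuous_map_left) simp
  then have f'\<phi>: "homotopic_with (\<lambda>x. True) X X (f' \<circ> \<phi>) id"
    using f'g' homotopic_with_symD homotopic_with_trans by blast
  show ?thesis
  \<comment> \<open>The pairs \<open>f'\<close>, \<open>f\<close> and \<open>\<phi>\<close>,
    \<open>g\<close> exchange roles; the cancelled composites are \<open>\<phi> \<circ> f'\<close>
    over \<open>g \<circ> f\<close>, then \<open>f' \<circ> \<phi>\<close> over
    \<open>f \<circ> g\<close>.\<close>
  proof (rule antisym)
    show "sequential_parametrized_TC n E p \<le> sequential_parametrized_TC n X q"
      using assms(1,2) f' qf' \<phi> p\<phi> \<phi>f' gf by (rule sequential_parametrized_TC_le)
    show "sequential_parametrized_TC n X q \<le> sequential_parametrized_TC n E p"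
      using assms(1,3) \<phi> p\<phi> f' qf' f'\<phi> fg by (rule sequential_parametrized_TC_le)
  qed
qed

end
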